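(* Let $T=(V,E)$ be a finite tree that is not a path or a star, and let its metric $w(t)$ evolve under the Ricci flow $\frac{d}{dt}w_h=-\kappa_h w_h$, $h\in E$, from an initial metric in $\mathbb{R}_{>0}^E$. Let $e$ be a leaf edge. If $w_e(t)\to\infty$ as $t\to\infty$, then there exists a time $t_0$ such that $\kappa_e(t)<0$ for all $t\ge t_0$; that is, $w_e(t)$ is monotonically increasing for $t\ge t_0$.
   Context: Trees are finite and connected; $d_u$ is the degree of $u$. Leaf edge: an edge with an endpoint of degree $1$. For a metric $w\in\mathbb{R}_{>0}^{E}$, let $d(x,y)$ be the weighted path distance and $D_x=\sum_{z\sim x}1/w_{xz}$. The curvature is the Lin-Lu-Yau version of Ollivier Ricci curvature with parameter function $\gamma(x)=1/x$: let $\mu_x^\alpha$ be the probability measure with $\mu_x^\alpha(x)=\alpha$, $\mu_x^\alpha(y)=(1-\alpha)\frac{1/w_{xy}}{D_x}$ for $y\sim x$, and $0$ otherwise; with $W$ the $L^1$ transportation distance for $d$, set $\kappa_\alpha(x,y)=1-W(\mu_x^\alpha,\mu_y^\alpha)/d(x,y)$ and $\kappa_{xy}=\lim_{\alpha\to1}\kappa_\alpha(x,y)/(1-\alpha)$. On a tree, for an edge $uv$, $\kappa_{uv}=\frac{2-d_u}{w_{uv}D_u}+\frac{2-d_v}{w_{uv}D_v}$. $\kappa_e(t)$ is the curvature with respect to $w(t)$. The flow has a unique positive solution for all $t\ge0$. *)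

theory Defs
  imports Complex_Main
begin

definition simple_graph :: "'a set \<Rightarrow> 'a set set \<Rightarrow> bool" where
  "simple_graph V E \<longleftrightarrow> finite V \<and> (\<forall>e\<in>E. e \<subseteq> V \<and> card e = 2)"

definition neighbours :: "'a set set \<Rightarrow> 'a \<Rightarrow> 'a set" where
  "neighbours E x = {y. {x, y} \<in> E}"

definition degree :: "'a set set \<Rightarrow> 'a \<Rightarrow> nat" where
  "degree E x = card (neighbours E x)"

definition paths_between :: "'a set \<Rightarrow> 'a set set \<Rightarrow> 'a \<Rightarrow> 'a \<Rightarrow> 'a list set" where
  "paths_between V E x y =
    {p. p \<noteq> [] \<and> set p \<subseteq> V \<and> distinct p \<and> successively (\<lambda>a b. {a, b} \<in> E) p
        \<and> hd p = x \<and> last p = y}"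

definition connected_graph :: "'a set \<Rightarrow> 'a set set \<Rightarrow> bool" where
  "connected_graph V E \<longleftrightarrow> V \<noteq> {} \<and> (\<forall>x\<in>V. \<forall>y\<in>V. paths_between V E x y \<noteq> {})"

definition is_cycle :: "'a set set \<Rightarrow> 'a list \<Rightarrow> bool" where
  "is_cycle E c \<longleftrightarrow>
    length c \<ge> 3 \<and> distinct c \<and> successively (\<lambda>a b. {a, b} \<in> E) c \<and> {last c, hd c} \<in> E"

definition is_tree :: "'a set \<Rightarrow> 'a set set \<Rightarrow> bool" where
  "is_tree V E \<longleftrightarrow> simple_graph V E \<and> connected_graph V E \<and> (\<nexists>c. is_cycle E c)"

definition is_path_graph :: "'a set \<Rightarrow> 'a set set \<Rightarrow> bool" where
  "is_path_graph V E \<longleftrightarrow>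
    (\<exists>p. p \<noteq> [] \<and> distinct p \<and> set p = V \<and> E = set (map2 (\<lambda>a b. {a, b}) p (tl p)))"

definition is_star_graph :: "'a set \<Rightarrow> 'a set set \<Rightarrow> bool" where
  "is_star_graph V E \<longleftrightarrow> (\<exists>c\<in>V. E = {{c, x} | x. x \<in> V - {c}})"

definition is_leaf_edge :: "'a set set \<Rightarrow> 'a set \<Rightarrow> bool" where
  "is_leaf_edge E e \<longleftrightarrow> e \<in> E \<and> (\<exists>x\<in>e. degree E x = 1)"

definition path_length :: "('a set \<Rightarrow> real) \<Rightarrow> 'a list \<Rightarrow> real" where
  "path_length w p = sum_list (map2 (\<lambda>a b. w {a, b}) p (tl p))"

definition path_dist :: "'a set \<Rightarrow> 'a set set \<Rightarrow> ('a set \<Rightarrow> real) \<Rightarrow> 'a \<Rightarrow> 'a \<Rightarrow> real" where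
  "path_dist V E w x y = Inf (path_length w ` paths_between V E x y)"

definition weighted_degree :: "'a set set \<Rightarrow> ('a set \<Rightarrow> real) \<Rightarrow> 'a \<Rightarrow> real" where
  "weighted_degree E w x = (\<Sum>z\<in>neighbours E x. 1 / w {x, z})"

text \<open>Measures on the finite set \<open>V\<close> are represented by their point masses.\<close>

definition walk_measure :: "'a set set \<Rightarrow> ('a set \<Rightarrow> real) \<Rightarrow> real \<Rightarrow> 'a \<Rightarrow> 'a \<Rightarrow> real" where
  "walk_measure E w \<alpha> x y =
    (if y = x then \<alpha>
     else if {x, y} \<in> E then (1 - \<alpha>) * ((1 / w {x, y}) / weighted_degree E w x)
     else 0)"

definition couplings :: "'a set \<Rightarrow> ('a \<Rightarrow> real) \<Rightarrow> ('a \<Rightarrow> real) \<Rightarrow> ('a \<Rightarrow> 'a \<Rightarrow> real) set" where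
  "couplings V \<mu> \<nu> =
    {\<pi>. (\<forall>x\<in>V. \<forall>y\<in>V. \<pi> x y \<ge> 0)
        \<and> (\<forall>x\<in>V. (\<Sum>y\<in>V. \<pi> x y) = \<mu> x)
        \<and> (\<forall>y\<in>V. (\<Sum>x\<in>V. \<pi> x y) = \<nu> y)}"

definition transport_dist ::
  "'a set \<Rightarrow> ('a \<Rightarrow> 'a \<Rightarrow> real) \<Rightarrow> ('a \<Rightarrow> real) \<Rightarrow> ('a \<Rightarrow> real) \<Rightarrow> real" where
  "transport_dist V d \<mu> \<nu> =
    Inf ((\<lambda>\<pi>. \<Sum>x\<in>V. \<Sum>y\<in>V. \<pi> x y * d x y) ` couplings V \<mu> \<nu>)"

definition alpha_curvature ::
  "'a set \<Rightarrow> 'a set set \<Rightarrow> ('a set \<Rightarrow> real) \<Rightarrow> real \<Rightarrow> 'a \<Rightarrow> 'a \<Rightarrow> real" where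
  "alpha_curvature V E w \<alpha> x y =
    1 - transport_dist V (path_dist V E w) (walk_measure E w \<alpha> x) (walk_measure E w \<alpha> y)
        / path_dist V E w x y"

text \<open>The limit is one-sided, since \<open>walk_measure\<close> is a probability measure only for
  \<open>\<alpha> \<in> {0..1}\<close>.\<close>

definition curvature ::
  "'a set \<Rightarrow> 'a set set \<Rightarrow> ('a set \<Rightarrow> real) \<Rightarrow> 'a \<Rightarrow> 'a \<Rightarrow> real" where
  "curvature V E w x y = Lim (at_left 1) (\<lambda>\<alpha>. alpha_curvature V E w \<alpha> x y / (1 - \<alpha>))"

text \<open>A metric is a function on edges; its values outside \<open>E\<close> are irrelevant, as are the values
  of the flow at negative times.  The derivative at time \<open>0\<close> is one-sided.\<close>

definition ricci_flow ::
  "'a set \<Rightarrow> 'a set set \<Rightarrow> (real \<Rightarrow> 'a set \<Rightarrow> real) \<Rightarrow> bool" where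
  "ricci_flow V E w \<longleftrightarrow>
    (\<forall>t\<ge>0. \<forall>h\<in>E. w t h > 0) \<and>
    (\<forall>t\<ge>0. \<forall>x y. {x, y} \<in> E \<longrightarrow>
      ((\<lambda>s. w s {x, y}) has_real_derivative - curvature V E (w t) x y * w t {x, y})
        (at t within {0..}))"

end

theory Submission
  imports Defs "HOL-Analysis.Derivative"
begin

text \<open>On a tree the transport problem for an edge \<open>xy\<close> is solved by a potential with prescribed
  edge differences, which gives the explicit curvature. For a leaf \<open>u\<close> attached to \<open>v\<close> the flow
  then reads \<open>x' = F - x\<close> with \<open>x = w_uv\<close> and \<open>F = (d_v - 2) / D_v\<close>. Every leaf edge at \<open>v\<close>
  satisfies this same equation, so the leaf edges at \<open>v\<close> differ by \<open>O(exp (- t))\<close>, while every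
  other edge \<open>y\<close> at \<open>v\<close> has \<open>y' \<ge> F\<close>. Let \<open>m\<close> be the number of leaf edges and \<open>n\<close> that of the
  other edges at \<open>v\<close>. If \<open>n \<le> 2\<close>, then \<open>x' = O(exp (- t))\<close> and \<open>x\<close> stays bounded. Otherwise put
  \<open>A = \<Sum> x / y\<close> over the non-leaf edges and \<open>B = \<Sum> x / y\<close> over the leaf edges. Then \<open>B\<close> tends
  to \<open>m\<close> and, by Cauchy-Schwarz, \<open>A' \<le> (m + n - 2) / (B + A) * (A - A\<^sup>2 / n) - A\<close>. As \<open>n \<ge> 3\<close>,
  this is at most a negative constant as long as \<open>A \<ge> n - 2.1\<close>. Hence eventually
  \<open>A + B < m + n - 2\<close>, which says \<open>F > x\<close>, that is, negative curvature.\<close>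

section \<open>Reachability and potentials in acyclic graphs\<close>

definition adj :: "'a set set \<Rightarrow> ('a \<times> 'a) set" where
  "adj E = {(a, b). {a, b} \<in> E}"

text \<open>Loop erasure, one edge at a time: if the new vertex already lies on the path, the path
  is cut there instead of extended.\<close>

lemma simple_path_of_rtrancl:
  assumes "(a, b) \<in> (adj E)\<^sup>*"
  shows "\<exists>p. p \<noteq> [] \<and> distinct p \<and> successively (\<lambda>a b. {a, b} \<in> E) p \<and> hd p = a \<and> last p = b"
  using assms
proof (induction rule: rtrancl_induct)
  case base
  show ?case by (rule exI[of _ "[a]"]) simp
next
  case (step b c)
  then obtain p where p: "p \<noteq> []" "distinct p" "successively (\<lambda>a b. {a, b} \<in> E) p" "hd p = a" "last p = b"
    by blast
  show ?case
  proof (cases "c \<in> set p")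
    case True
    then obtain q r where qr: "p = q @ c # r" by (meson split_list)
    have "hd (q @ [c]) = a" using p(4) qr by (cases q) auto
    moreover have "successively (\<lambda>a b. {a, b} \<in> E) (q @ [c])"
      using p(3) unfolding qr by (auto simp: successively_append_iff)
    moreover have "distinct (q @ [c])" using p(2) qr by auto
    ultimately show ?thesis by (intro exI[of _ "q @ [c]"]) auto
  next
    case False
    have "{b, c} \<in> E" using step(2) by (simp add: adj_def)
    then show ?thesis using p False
      by (intro exI[of _ "p @ [c]"]) (auto simp: successively_append_iff)
  qed
qed

text \<open>The edge \<open>{a, b}\<close> would close a simple path from \<open>a\<close> to
  \<open>b\<close> in \<open>E\<close> to a cycle.\<close>

lemma bridge_if_no_cycle:
  assumes "\<nexists>c. is_cycle (insert {a, b} E) c" "{a, b} \<notin> E" "a \<noteq> b"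
  shows "(a, b) \<notin> (adj E)\<^sup>*"
proof
  assume "(a, b) \<in> (adj E)\<^sup>*"
  then obtain p where p: "p \<noteq> []" "distinct p" "successively (\<lambda>a b. {a, b} \<in> E) p" "hd p = a" "last p = b"
    using simple_path_of_rtrancl[of a b E] by blast
  \<comment> \<open>A single vertex would force \<open>a = b\<close>, and two would put
    \<open>{a, b}\<close> into \<open>E\<close>.\<close>
  have "length p \<ge> 3"
  proof (rule ccontr)
    assume "\<not> length p \<ge> 3"
    moreover have "length p \<noteq> 0" "length p \<noteq> 1"
      using p assms(3) by (auto simp: length_Suc_conv)
    ultimately have "length p = 2" by linarith
    then obtain c d where "p = [c, d]" by (auto simp: length_Suc_conv numeral_2_eq_2)
    then show False using p assms(2) by auto
  qed
  moreover have "successively (\<lambda>x y. {x, y} \<in> insert {a, b} E) p"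
    using p(3) by (rule successively_mono) auto
  ultimately have "is_cycle (insert {a, b} E) p"
    using p by (auto simp: is_cycle_def insert_commute)
  then show False using assms(1) by blast
qed

lemma is_cycle_mono: "is_cycle E c \<Longrightarrow> E \<subseteq> E' \<Longrightarrow> is_cycle E' c"
  unfolding is_cycle_def by (auto elim: successively_mono)

text \<open>Only cycles could impose conditions on \<open>c\<close> beyond antisymmetry. Edges are
  added one at a time, and each new edge is a bridge.\<close>

lemma acyclic_potential:
  fixes c :: "'a \<Rightarrow> 'a \<Rightarrow> real"
  assumes "finite E" "\<And>e. e \<in> E \<Longrightarrow> card e = 2" "\<nexists>p. is_cycle E p"
    and "\<And>a b. {a, b} \<in> E \<Longrightarrow> c a b = - c b a"
  shows "\<exists>f. \<forall>a b. {a, b} \<in> E \<longrightarrow> f a - f b = c a b"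
  using assms
proof (induction E rule: finite_induct)
  case empty
  show ?case by simp
next
  case (insert e E)
  have "\<nexists>p. is_cycle E p" using insert.prems(2) is_cycle_mono[of E _ "insert e E"] by blast
  then obtain f where f: "\<And>a b. {a, b} \<in> E \<Longrightarrow> f a - f b = c a b"
    using insert.IH insert.prems by auto
  obtain a b where e: "e = {a, b}" and ab: "a \<noteq> b"
    using insert.prems(1)[of e] by (auto simp: card_2_iff)
  have nreach: "(a, b) \<notin> (adj E)\<^sup>*"
    using bridge_if_no_cycle insert.prems(2) insert.hyps(2) ab unfolding e by metis
  \<comment> \<open>Shifting \<open>f\<close> by a constant on the old component of \<open>a\<close>
    keeps all old differences; \<open>b\<close> lies outside it, so the constant can be fitted to
    the new edge.\<close>
  define g where "g z = (if (a, z) \<in> (adj E)\<^sup>* then f z + (c a b - (f a - f b)) else f z)" for z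
  have "g x - g y = c x y" if xy: "{x, y} \<in> insert e E" for x y
  proof (cases "{x, y} \<in> E")
    case True
    then have "(x, y) \<in> adj E" "(y, x) \<in> adj E" by (auto simp: adj_def insert_commute)
    then have "(a, x) \<in> (adj E)\<^sup>* \<longleftrightarrow> (a, y) \<in> (adj E)\<^sup>*" by (meson rtrancl.rtrancl_into_rtrancl)
    then show ?thesis using f[OF True] by (simp add: g_def)
  next
    case False
    then have "x = a \<and> y = b \<or> x = b \<and> y = a" using xy by (auto simp: e doubleton_eq_iff)
    moreover have "g a - g b = c a b" using nreach by (simp add: g_def)
    moreover have "c a b = - c b a" using insert.prems(3)[of a b] e by simp
    ultimately show ?thesis by auto
  qed
  then show ?case by blast
qed

section \<open>Path distance and random-walk measures on a weighted tree\<close>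

locale weighted_tree =
  fixes V :: "'a set" and E :: "'a set set" and w :: "'a set \<Rightarrow> real"
  assumes tree: "is_tree V E" and pos: "h \<in> E \<Longrightarrow> 0 < w h"
begin

lemma finite_V: "finite V"
  and edge_subset: "e \<in> E \<Longrightarrow> e \<subseteq> V"
  and edge_card: "e \<in> E \<Longrightarrow> card e = 2"
  and no_cycle: "\<nexists>c. is_cycle E c"
  and paths_nonempty: "x \<in> V \<Longrightarrow> y \<in> V \<Longrightarrow> paths_between V E x y \<noteq> {}"
  using tree by (auto simp: is_tree_def simple_graph_def connected_graph_def)

lemma finite_E: "finite E"
  using finite_V edge_subset by (meson PowI finite_Pow_iff finite_subset subsetI)

lemma edge_neq: "{a, b} \<in> E \<Longrightarrow> a \<noteq> b"
  using edge_card by fastforce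

lemma neighbours_subset: "neighbours E x \<subseteq> V"
  using edge_subset by (auto simp: neighbours_def)

lemma finite_neighbours: "finite (neighbours E x)"
  using neighbours_subset finite_V finite_subset by blast

lemma weighted_degree_pos:
  assumes "{x, y} \<in> E"
  shows "0 < weighted_degree E w x"
  unfolding weighted_degree_def
  using assms finite_neighbours[of x]
  by (intro sum_pos2[of _ y]) (auto simp: neighbours_def pos less_imp_le)

lemma path_length_ge:
  assumes "\<And>a b. {a, b} \<in> E \<Longrightarrow> f a - f b \<le> w {a, b}"
    and "p \<noteq> []" "successively (\<lambda>a b. {a, b} \<in> E) p"
  shows "f (hd p) - f (last p) \<le> path_length w p"
  using assms(2,3)
proof (induction p rule: induct_list012)
  case (3 a b p)
  then have "f b - f (last (b # p)) \<le> path_length w (b # p)" by auto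
  moreover have "f a - f b \<le> w {a, b}" using 3 assms(1) by auto
  ultimately show ?case by (simp add: path_length_def)
qed (simp_all add: path_length_def)

lemma path_dist_ge:
  assumes "\<And>a b. {a, b} \<in> E \<Longrightarrow> f a - f b \<le> w {a, b}" "x \<in> V" "y \<in> V"
  shows "f x - f y \<le> path_dist V E w x y"
  unfolding path_dist_def using path_length_ge[OF assms(1)] paths_nonempty[OF assms(2,3)]
  by (intro cInf_greatest) (fastforce simp: paths_between_def)+

text \<open>Every step attains the Lipschitz bound, so the length of \<open>p\<close> telescopes to
  the lower bound valid for all paths. Uniqueness of paths in a tree is thus avoided.\<close>

lemma path_dist_descending:
  assumes f: "\<And>a b. {a, b} \<in> E \<Longrightarrow> f a - f b \<le> w {a, b}"
    and p: "p \<noteq> []" "set p \<subseteq> V" "successively (\<lambda>a b. {a, b} \<in> E \<and> f a - f b = w {a, b}) p"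
  shows "path_dist V E w (hd p) (last p) = f (hd p) - f (last p)"
proof (rule antisym)
  \<comment> \<open>Weights are positive, so \<open>f\<close> strictly decreases along
    \<open>p\<close>; that \<open>f\<close> is largest at the head is carried along to get
    distinctness.\<close>
  have "distinct p \<and> (\<forall>z\<in>set p. f z \<le> f (hd p)) \<and> path_length w p = f (hd p) - f (last p)"
    using p(1,3)
  proof (induction p rule: induct_list012)
    case (3 a b p)
    then have "distinct (b # p)" "\<forall>z\<in>set (b # p). f z \<le> f b"
      "path_length w (b # p) = f b - f (last (b # p))" by auto
    moreover have "f a - f b = w {a, b}" "w {a, b} > 0" using 3 pos by auto
    ultimately show ?case by (force simp: path_length_def)
  qed (simp_all add: path_length_def)
  moreover have "successively (\<lambda>a b. {a, b} \<in> E) p"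
    using p(3) by (rule successively_mono) auto
  ultimately have mem: "f (hd p) - f (last p) \<in> path_length w ` paths_between V E (hd p) (last p)"
    using p by (intro image_eqI[of _ _ p]) (auto simp: paths_between_def)
  have "bdd_below (path_length w ` paths_between V E (hd p) (last p))"
    using path_length_ge[OF f] by (intro bdd_belowI[of _ "f (hd p) - f (last p)"]) (fastforce simp: paths_between_def)
  then show "path_dist V E w (hd p) (last p) \<le> f (hd p) - f (last p)"
    unfolding path_dist_def using mem by (rule cInf_lower[rotated])
  show "f (hd p) - f (last p) \<le> path_dist V E w (hd p) (last p)"
    using p by (intro path_dist_ge f) auto
qed

lemma walk_measure_sum:
  assumes "x \<in> V"
  shows "(\<Sum>z\<in>V. walk_measure E w \<alpha> x z * g z) =
    \<alpha> * g x + (1 - \<alpha>) * (\<Sum>z\<in>neighbours E x. 1 / w {x, z} * g z) / weighted_degree E w x"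
proof -
  have "x \<notin> neighbours E x" using edge_neq[of x x] by (auto simp: neighbours_def)
  have "(\<Sum>z\<in>V. walk_measure E w \<alpha> x z * g z) =
      \<alpha> * g x + (\<Sum>z\<in>V - {x}. walk_measure E w \<alpha> x z * g z)"
    using assms finite_V by (simp add: sum.remove walk_measure_def)
  also have "(\<Sum>z\<in>V - {x}. walk_measure E w \<alpha> x z * g z) =
      (\<Sum>z\<in>neighbours E x. walk_measure E w \<alpha> x z * g z)"
    using \<open>x \<notin> neighbours E x\<close> neighbours_subset finite_V
    by (intro sum.mono_neutral_right) (auto simp: walk_measure_def neighbours_def)
  also have "\<dots> = (\<Sum>z\<in>neighbours E x. (1 - \<alpha>) / weighted_degree E w x * (1 / w {x, z} * g z))" (is "_ = ?R")
    using \<open>x \<notin> neighbours E x\<close> by (intro sum.cong) (auto simp: walk_measure_def neighbours_def)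
  also have "?R = (1 - \<alpha>) * (\<Sum>z\<in>neighbours E x. 1 / w {x, z} * g z) / weighted_degree E w x"
    by (subst sum_distrib_left[symmetric]) simp
  finally show ?thesis .
qed

lemma walk_measure_total:
  assumes "{x, y} \<in> E"
  shows "(\<Sum>z\<in>V. walk_measure E w \<alpha> x z) = 1"
  using walk_measure_sum[of x \<alpha> "\<lambda>_. 1"] weighted_degree_pos[OF assms] edge_subset[OF assms]
  by (simp add: weighted_degree_def)

lemma walk_measure_nonneg:
  assumes "0 \<le> \<alpha>" "\<alpha> \<le> 1"
  shows "0 \<le> walk_measure E w \<alpha> x z"
proof -
  have "0 \<le> weighted_degree E w x"
    unfolding weighted_degree_def by (rule sum_nonneg) (auto simp: neighbours_def pos less_imp_le)
  then show ?thesis using assms pos[of "{x, z}"] by (auto simp: walk_measure_def)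
qed

text \<open>The conductances \<open>1 / w\<close> cancel the edge lengths, so every neighbour contributes the same
  amount up to sign.\<close>

lemma walk_measure_sum_unit_slope:
  assumes xy: "{x, y} \<in> E"
    and "\<And>z. z \<in> neighbours E x \<Longrightarrow> g z = g x + (if z = y then - s else s) * w {x, z}"
  shows "(\<Sum>z\<in>V. walk_measure E w \<alpha> x z * g z) =
    g x + s * ((1 - \<alpha>) * ((real (degree E x) - 2) / weighted_degree E w x))"
proof -
  let ?N = "neighbours E x" and ?D = "weighted_degree E w x"
  have y: "y \<in> ?N" and x: "x \<in> V" using xy edge_subset by (auto simp: neighbours_def)
  have D: "?D > 0" using weighted_degree_pos xy .
  have "(\<Sum>z\<in>?N. 1 / w {x, z} * g z) =
      (\<Sum>z\<in>?N. g x * (1 / w {x, z}) + (if z = y then - s else s))"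
  proof (rule sum.cong)
    fix z assume "z \<in> ?N"
    moreover from this have "w {x, z} > 0" using pos by (auto simp: neighbours_def)
    ultimately show "1 / w {x, z} * g z = g x * (1 / w {x, z}) + (if z = y then - s else s)"
      using assms(2) by (simp add: field_simps)
  qed simp
  also have "\<dots> = g x * ?D + (\<Sum>z\<in>?N. if z = y then - s else s)"
    by (simp add: sum.distrib sum_distrib_left weighted_degree_def)
  also have "(\<Sum>z\<in>?N. if z = y then - s else s) = s * (real (degree E x) - 2)"
  proof -
    have "real (card (?N - {y})) = real (degree E x) - 1"
      using y finite_neighbours card_gt_0_iff[of ?N]
      by (auto simp: degree_def card_Diff_singleton of_nat_diff)
    moreover have "(\<Sum>z\<in>?N. if z = y then - s else s) = - s + (\<Sum>z\<in>?N - {y}. s)"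
      by (subst sum.remove[OF finite_neighbours y]) (auto intro!: sum.cong)
    ultimately have "(\<Sum>z\<in>?N. if z = y then - s else s) = - s + (real (degree E x) - 1) * s" by simp
    then show ?thesis by (simp add: algebra_simps)
  qed
  finally have "(\<Sum>z\<in>V. walk_measure E w \<alpha> x z * g z) =
      \<alpha> * g x + (1 - \<alpha>) * (g x * ?D + s * (real (degree E x) - 2)) / ?D"
    using walk_measure_sum[OF x, of \<alpha> g] by simp
  then show ?thesis using D by (simp add: field_simps)
qed

end

section \<open>Couplings and Kantorovich duality\<close>

lemma sum_delta_pair:
  fixes c :: real
  assumes "finite V" "a \<in> V" "b \<in> V"
  shows "(\<Sum>y\<in>V. if x = a \<and> y = b then c else 0) = (if x = a then c else 0)"
    and "(\<Sum>x\<in>V. if x = a \<and> y = b then c else 0) = (if y = b then c else 0)"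
  using assms by (cases "x = a"; simp)(cases "y = b"; simp add: assms)

text \<open>The product coupling, corrected by exchanging targets so that nothing moves from \<open>q\<close>
  to \<open>p\<close>.\<close>

lemma coupling_avoiding_pair:
  fixes \<mu> \<nu> :: "'a \<Rightarrow> real"
  assumes "finite V" "p \<in> V" "q \<in> V" "p \<noteq> q"
    and nonneg: "\<And>z. z \<in> V \<Longrightarrow> 0 \<le> \<mu> z" "\<And>z. z \<in> V \<Longrightarrow> 0 \<le> \<nu> z"
    and total: "(\<Sum>z\<in>V. \<mu> z) = 1" "(\<Sum>z\<in>V. \<nu> z) = 1"
    and le: "\<mu> q * \<nu> p \<le> \<mu> p * \<nu> q"
  obtains \<pi> where "\<pi> \<in> couplings V \<mu> \<nu>" "\<pi> q p = 0"
    "\<And>a b. a \<in> V \<Longrightarrow> b \<in> V \<Longrightarrow> \<pi> a b \<noteq> 0 \<Longrightarrow> \<mu> a \<noteq> 0 \<and> \<nu> b \<noteq> 0 \<or> a = b"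
proof
  \<comment> \<open>\<open>\<beta>\<close> is the product mass sent from \<open>q\<close> to
    \<open>p\<close>. It is taken off \<open>(q, p)\<close> and \<open>(p, q)\<close> and put on the
    diagonal, which keeps the marginals; \<open>le\<close> keeps the entry at \<open>(p, q)\<close>
    nonnegative.\<close>
  define \<beta> where "\<beta> = \<mu> q * \<nu> p"
  define \<pi> where "\<pi> a b = \<mu> a * \<nu> b
      + (if a = p \<and> b = p then \<beta> else 0) + (if a = q \<and> b = q then \<beta> else 0)
      - (if a = p \<and> b = q then \<beta> else 0) - (if a = q \<and> b = p then \<beta> else 0)" for a b
  have b0: "\<beta> \<ge> 0" using nonneg assms by (simp add: \<beta>_def)
  have "0 \<le> \<pi> a b" if "a \<in> V" "b \<in> V" for a b
    using nonneg[of a] nonneg(2)[of b] that b0 le \<open>p \<noteq> q\<close> unfolding \<pi>_def by (auto simp: \<beta>_def)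
  moreover have "(\<Sum>b\<in>V. \<pi> a b) = \<mu> a" if "a \<in> V" for a
    using assms(1-4) total
    by (simp add: \<pi>_def sum.distrib sum_subtractf sum_delta_pair sum_distrib_left[symmetric])
  moreover have "(\<Sum>a\<in>V. \<pi> a b) = \<nu> b" if "b \<in> V" for b
    using assms(1-4) total
    by (simp add: \<pi>_def sum.distrib sum_subtractf sum_delta_pair sum_distrib_right[symmetric])
  ultimately show "\<pi> \<in> couplings V \<mu> \<nu>" by (auto simp: couplings_def)
  show "\<pi> q p = 0" using \<open>p \<noteq> q\<close> by (simp add: \<pi>_def \<beta>_def)
  show "\<mu> a \<noteq> 0 \<and> \<nu> b \<noteq> 0 \<or> a = b" if "a \<in> V" "b \<in> V" "\<pi> a b \<noteq> 0" for a b
    using that le b0 \<open>p \<noteq> q\<close> by (auto simp: \<pi>_def \<beta>_def split: if_splits)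
qed

text \<open>The cost splits into a source term and a target term, so only the marginals
  matter.\<close>

lemma coupling_potential_sum:
  fixes f :: "'a \<Rightarrow> real"
  assumes "finite V" "\<pi> \<in> couplings V \<mu> \<nu>"
  shows "(\<Sum>x\<in>V. \<Sum>y\<in>V. \<pi> x y * (f x - f y)) = (\<Sum>x\<in>V. \<mu> x * f x) - (\<Sum>y\<in>V. \<nu> y * f y)"
proof -
  have "(\<Sum>x\<in>V. \<Sum>y\<in>V. \<pi> x y * (f x - f y)) =
      (\<Sum>x\<in>V. \<Sum>y\<in>V. \<pi> x y * f x) - (\<Sum>y\<in>V. \<Sum>x\<in>V. \<pi> x y * f y)"
    using sum.swap[of "\<lambda>x y. \<pi> x y * f y" V V] by (simp add: right_diff_distrib sum_subtractf)
  then show ?thesis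
    using assms(2) by (simp add: sum_distrib_right[symmetric] couplings_def)
qed

text \<open>Weak duality with complementary slackness: \<open>f\<close> bounds the cost of every
  coupling from below, and \<open>\<pi>\<close> charges only pairs where that bound is
  attained.\<close>

lemma transport_dist_eq_potential:
  fixes f :: "'a \<Rightarrow> real"
  assumes "finite V" "\<pi> \<in> couplings V \<mu> \<nu>"
    and lip: "\<And>x y. x \<in> V \<Longrightarrow> y \<in> V \<Longrightarrow> f x - f y \<le> d x y"
    and tight: "\<And>x y. x \<in> V \<Longrightarrow> y \<in> V \<Longrightarrow> \<pi> x y \<noteq> 0 \<Longrightarrow> d x y = f x - f y"
  shows "transport_dist V d \<mu> \<nu> = (\<Sum>x\<in>V. \<mu> x * f x) - (\<Sum>y\<in>V. \<nu> y * f y)"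
  unfolding transport_dist_def
proof (rule cInf_eq_minimum)
  have "(\<Sum>x\<in>V. \<Sum>y\<in>V. \<pi> x y * d x y) = (\<Sum>x\<in>V. \<Sum>y\<in>V. \<pi> x y * (f x - f y))"
    using tight by (intro sum.cong refl) (metis mult_zero_left)
  then show "(\<Sum>x\<in>V. \<mu> x * f x) - (\<Sum>y\<in>V. \<nu> y * f y)
      \<in> (\<lambda>\<pi>. \<Sum>x\<in>V. \<Sum>y\<in>V. \<pi> x y * d x y) ` couplings V \<mu> \<nu>"
    using coupling_potential_sum[OF assms(1,2), of f] assms(2) by (metis (no_types, lifting) image_eqI)
next
  fix c assume "c \<in> (\<lambda>\<pi>. \<Sum>x\<in>V. \<Sum>y\<in>V. \<pi> x y * d x y) ` couplings V \<mu> \<nu>"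
  then obtain \<rho> where \<rho>: "\<rho> \<in> couplings V \<mu> \<nu>" and c: "c = (\<Sum>x\<in>V. \<Sum>y\<in>V. \<rho> x y * d x y)"
    by blast
  have "(\<Sum>x\<in>V. \<Sum>y\<in>V. \<rho> x y * (f x - f y)) \<le> c"
    unfolding c using \<rho> lip by (intro sum_mono mult_left_mono) (auto simp: couplings_def)
  then show "(\<Sum>x\<in>V. \<mu> x * f x) - (\<Sum>y\<in>V. \<nu> y * f y) \<le> c"
    using coupling_potential_sum[OF assms(1) \<rho>, of f] by simp
qed

section \<open>The explicit curvature of an edge\<close>

context weighted_tree
begin

text \<open>One potential is optimal for all \<open>\<alpha>\<close> from \<open>1/2\<close> up to
  \<open>1\<close>. Hence the transport distance is affine in \<open>\<alpha>\<close> there, and the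
  quotient under the limit is constant.\<close>

lemma curvature_edge:
  assumes xy: "{x, y} \<in> E"
  shows "curvature V E w x y =
    (2 - real (degree E x)) / (w {x, y} * weighted_degree E w x)
    + (2 - real (degree E y)) / (w {x, y} * weighted_degree E w y)"
proof -
  have neq: "x \<noteq> y" and V: "x \<in> V" "y \<in> V" using edge_neq edge_subset xy by auto
  have yx: "{y, x} \<in> E" using xy by (simp add: insert_commute)
  \<comment> \<open>The Kantorovich potential decreases at unit speed along every path crossing from the side of
    \<open>x\<close> to the side of \<open>y\<close>.\<close>
  define down where "down a b \<longleftrightarrow> b = x \<and> a \<noteq> y \<or> a = y \<and> b \<noteq> x \<or> a = x \<and> b = y" for a b
  \<comment> \<open>The difference is 0 on edges that meet neither \<open>x\<close> nor
    \<open>y\<close>: both measures live on \<open>x\<close>, \<open>y\<close> and their neighbours,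
    so elsewhere the Lipschitz bound is enough.\<close>
  define c where "c a b = (if down a b then w {a, b} else if down b a then - w {a, b} else 0)" for a b
  have asym: "\<not> (down a b \<and> down b a)" if "a \<noteq> b" for a b
    using that neq by (auto simp: down_def)
  have "c a b = - c b a" if "{a, b} \<in> E" for a b
    using asym[OF edge_neq[OF that]] by (simp add: c_def insert_commute[of b a])
  then have "\<exists>f. \<forall>a b. {a, b} \<in> E \<longrightarrow> f a - f b = c a b"
    by (intro acyclic_potential finite_E edge_card no_cycle)
  then obtain f where f: "\<And>a b. {a, b} \<in> E \<Longrightarrow> f a - f b = c a b" by blast
  have lip: "f a - f b \<le> w {a, b}" if "{a, b} \<in> E" for a b
    using f[OF that] pos[OF that] by (auto simp: c_def)
  have fxy: "f x - f y = w {x, y}" using f[OF xy] by (simp add: c_def down_def)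
  have fx: "f z - f x = w {z, x}" if "z \<in> neighbours E x" "z \<noteq> y" for z
    using f[of z x] that by (simp add: c_def down_def neighbours_def insert_commute[of x z])
  have fy: "f y - f z = w {y, z}" if "z \<in> neighbours E y" "z \<noteq> x" for z
    using f[of y z] that by (simp add: c_def down_def neighbours_def)
  have dist_xy: "path_dist V E w x y = w {x, y}"
    using path_dist_descending[OF lip, of "[x, y]"] V xy fxy by auto
  let ?K = "(real (degree E x) - 2) / weighted_degree E w x
    + (real (degree E y) - 2) / weighted_degree E w y"
  have transport: "transport_dist V (path_dist V E w) (walk_measure E w \<alpha> x) (walk_measure E w \<alpha> y)
      = w {x, y} + (1 - \<alpha>) * ?K" if \<alpha>: "1/2 \<le> \<alpha>" "\<alpha> < 1" for \<alpha>
  proof -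
    let ?\<mu> = "walk_measure E w \<alpha> x" and ?\<nu> = "walk_measure E w \<alpha> y"
    have nonneg: "0 \<le> ?\<mu> z" "0 \<le> ?\<nu> z" for z using walk_measure_nonneg \<alpha> by auto
    have total: "(\<Sum>z\<in>V. ?\<mu> z) = 1" "(\<Sum>z\<in>V. ?\<nu> z) = 1"
      using walk_measure_total xy yx by auto
    have self: "?\<mu> x = \<alpha>" "?\<nu> y = \<alpha>" by (auto simp: walk_measure_def)
    \<comment> \<open>As \<open>\<alpha>\<close> is at least \<open>1/2\<close>, each measure has at
      least as much mass at its centre as at the other endpoint, which permits the exchange. Mass
      moved from \<open>y\<close> to \<open>x\<close> would go against the potential.\<close>
    have "?\<mu> x + ?\<mu> y \<le> 1" "?\<nu> x + ?\<nu> y \<le> 1"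
      using sum_mono2[OF finite_V, of "{x, y}" ?\<mu>] sum_mono2[OF finite_V, of "{x, y}" ?\<nu>]
        V total nonneg neq by auto
    then have "?\<mu> y \<le> \<alpha>" "?\<nu> x \<le> \<alpha>" using self \<alpha> by auto
    then have le: "?\<mu> y * ?\<nu> x \<le> ?\<mu> x * ?\<nu> y" using nonneg \<alpha> self by (simp add: mult_mono)
    obtain \<pi> where \<pi>: "\<pi> \<in> couplings V ?\<mu> ?\<nu>" "\<pi> y x = 0"
      "\<And>a b. a \<in> V \<Longrightarrow> b \<in> V \<Longrightarrow> \<pi> a b \<noteq> 0 \<Longrightarrow> ?\<mu> a \<noteq> 0 \<and> ?\<nu> b \<noteq> 0 \<or> a = b"
      using coupling_avoiding_pair[OF finite_V V neq nonneg total le] by blast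
    have tight: "path_dist V E w a b = f a - f b" if ab: "a \<in> V" "b \<in> V" "\<pi> a b \<noteq> 0" for a b
    proof (cases "a = b")
      case True
      then show ?thesis using path_dist_descending[OF lip, of "[a]"] ab by auto
    next
      case False
      then have "?\<mu> a \<noteq> 0" "?\<nu> b \<noteq> 0" using \<pi>(3)[OF ab] by auto
      then have a: "a = x \<or> a = y \<or> a \<in> neighbours E x \<and> a \<noteq> y"
        and b: "b = x \<or> b = y \<or> b \<in> neighbours E y \<and> b \<noteq> x"
        by (auto simp: walk_measure_def neighbours_def split: if_splits)
      have "\<not> (a = y \<and> b = x)" using \<pi>(2) ab by auto
      note desc = path_dist_descending[OF lip]
      have e: "a \<in> neighbours E x \<Longrightarrow> {a, x} \<in> E" "b \<in> neighbours E y \<Longrightarrow> {y, b} \<in> E"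
        by (auto simp: neighbours_def insert_commute)
      \<comment> \<open>The path from \<open>a\<close> to \<open>b\<close> is cut at the edge
        \<open>xy\<close>: \<open>l\<close> runs up to \<open>x\<close>, \<open>r\<close> starts at
        \<open>y\<close>. One part is empty if the path starts at \<open>y\<close> or ends at
        \<open>x\<close>; both would be empty only for the excluded pair.\<close>
      define l where "l = (if a = y then [] else if a = x then [x] else [a, x])"
      define r where "r = (if b = x then [] else if b = y then [y] else [y, b])"
      have "successively (\<lambda>a b. {a, b} \<in> E \<and> f a - f b = w {a, b}) (l @ r)"
        using a b e fx fy fxy xy by (auto simp: l_def r_def successively_append_iff)
      moreover have "l @ r \<noteq> []" "set (l @ r) \<subseteq> V" "hd (l @ r) = a" "last (l @ r) = b"
        using a b V ab \<open>\<not> (a = y \<and> b = x)\<close> neq by (auto simp: l_def r_def)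
      ultimately show ?thesis using desc[of "l @ r"] by simp
    qed
    have "transport_dist V (path_dist V E w) ?\<mu> ?\<nu> = (\<Sum>z\<in>V. ?\<mu> z * f z) - (\<Sum>z\<in>V. ?\<nu> z * f z)"
      by (rule transport_dist_eq_potential[OF finite_V \<pi>(1) path_dist_ge[OF lip] tight])
    \<comment> \<open>Away from \<open>x\<close> the potential rises except towards
      \<open>y\<close>; away from \<open>y\<close> it falls except towards \<open>x\<close>. Hence
      the slopes \<open>1\<close> and \<open>-1\<close>.\<close>
    moreover have "(\<Sum>z\<in>V. ?\<mu> z * f z) =
        f x + (1 - \<alpha>) * ((real (degree E x) - 2) / weighted_degree E w x)"
      using fx fxy by (subst walk_measure_sum_unit_slope[OF xy, of f 1]) (force simp: insert_commute, simp)
    moreover have "(\<Sum>z\<in>V. ?\<nu> z * f z) =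
        f y - (1 - \<alpha>) * ((real (degree E y) - 2) / weighted_degree E w y)"
      using fy fxy
      by (subst walk_measure_sum_unit_slope[OF yx, of f "-1"])
        (force simp: insert_commute, simp)
    ultimately show ?thesis unfolding distrib_left using fxy by (simp only:)
  qed
  have "alpha_curvature V E w \<alpha> x y / (1 - \<alpha>) = - ?K / w {x, y}" if "1/2 \<le> \<alpha>" "\<alpha> < 1" for \<alpha>
  proof -
    have one_sub: "1 - (w {x, y} + (1 - \<alpha>) * k) / w {x, y} = (1 - \<alpha>) * (- k / w {x, y})" for k
      using pos[OF xy] by (simp add: field_simps)
    have "1 - \<alpha> \<noteq> 0" using that by simp
    then show ?thesis
      unfolding alpha_curvature_def transport[OF that] dist_xy one_sub
      by (rule nonzero_mult_div_cancel_left)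
  qed
  moreover have "eventually (\<lambda>\<alpha>::real. 1/2 \<le> \<alpha> \<and> \<alpha> < 1) (at_left 1)"
    by (rule eventually_at_leftI[of "1/2"]) auto
  ultimately have "eventually (\<lambda>\<alpha>. alpha_curvature V E w \<alpha> x y / (1 - \<alpha>) = - ?K / w {x, y}) (at_left 1)"
    by (auto elim: eventually_mono)
  then have "curvature V E w x y = - ?K / w {x, y}"
    unfolding curvature_def by (intro tendsto_Lim tendsto_eventually) auto
  then show ?thesis
    by (simp add: add_divide_distrib diff_divide_distrib mult.commute)
qed

end

section \<open>Asymptotics of the differential equations at a vertex\<close>

text \<open>At or above \<open>a\<close> the function falls at rate at least \<open>c\<close>, so it
  gets down to \<open>a\<close> in finite time, and it cannot rise from its last visit to that
  level.\<close>

lemma eventually_le_of_drift: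
  fixes f :: "real \<Rightarrow> real"
  assumes c: "c > 0"
    and f: "\<And>t. t \<ge> T \<Longrightarrow> (f has_real_derivative f' t) (at t)"
    and drift: "\<And>t. t \<ge> T \<Longrightarrow> a \<le> f t \<Longrightarrow> f' t \<le> - c"
  shows "eventually (\<lambda>t. f t \<le> a) at_top"
proof -
  have decr: "f t + c * t \<le> f s + c * s" if "T \<le> s" "s \<le> t" "\<And>r. s \<le> r \<Longrightarrow> r \<le> t \<Longrightarrow> a \<le> f r" for s t
  proof (rule DERIV_nonpos_imp_nonincreasing[OF that(2), of "\<lambda>t. f t + c * t"])
    fix r assume "s \<le> r" "r \<le> t"
    then show "\<exists>y. ((\<lambda>t. f t + c * t) has_real_derivative y) (at r) \<and> y \<le> 0"
      using that drift[of r] by (intro exI[of _ "f' r + c"]) (auto intro!: derivative_eq_intros f)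
  qed
  have "\<exists>s\<ge>T. f s \<le> a"
  proof (rule ccontr)
    assume "\<not> ?thesis"
    then have above: "f r > a" if "r \<ge> T" for r using that by force
    \<comment> \<open>At this time the line of slope \<open>- c\<close> through
      \<open>(T, f T)\<close> is down to \<open>a\<close>.\<close>
    define t where "t = T + (f T - a) / c"
    have "f T > a" using above by simp
    then have "T \<le> t" using c by (simp add: t_def)
    then have "f t + c * t \<le> f T + c * T" using above by (intro decr) (auto intro: less_imp_le)
    moreover have "c * t = c * T + (f T - a)" using c by (simp add: t_def field_simps)
    ultimately show False using above[OF \<open>T \<le> t\<close>] by simp
  qed
  then obtain s where s: "s \<ge> T" "f s \<le> a" by blast
  have "f t \<le> a" if "t \<ge> s" for t
  proof (rule ccontr)
    assume nt: "\<not> f t \<le> a"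
    \<comment> \<open>The maximum \<open>m\<close> of this set is the last time up to
      \<open>t\<close> with \<open>f\<close> at most \<open>a\<close>. By the intermediate value
      theorem \<open>f m = a\<close>, so the drift acts on all of \<open>{m..t}\<close>.\<close>
    let ?S = "{r \<in> {s..t}. f r \<le> a}"
    have cont: "continuous_on {s..t} f"
      using f s DERIV_isCont[OF f] by (intro continuous_at_imp_continuous_on) auto
    then have "closed ?S" by (rule continuous_on_closed_Collect_le) auto
    then have "compact ({s..t} \<inter> ?S)" by (intro compact_Int_closed) auto
    then have "compact ?S" by (simp add: Int_def conj_ac)
    moreover have "?S \<noteq> {}" using s that by auto
    ultimately have "\<exists>m\<in>?S. \<forall>r\<in>?S. r \<le> m" by (rule compact_attains_sup)
    then obtain m where m: "m \<in> ?S" "\<And>r. r \<in> ?S \<Longrightarrow> r \<le> m" by blast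
    have "m < t" using m nt by (cases "m = t") auto
    have "f m = a"
    proof (rule ccontr)
      assume "f m \<noteq> a"
      then obtain r where r: "m \<le> r" "r \<le> t" "f r = a"
        using IVT'[of f m a t] m nt \<open>m < t\<close> continuous_on_subset[OF cont, of "{m..t}"] by auto
      then have "r \<le> m" using m by auto
      then show False using r \<open>f m \<noteq> a\<close> by auto
    qed
    have "f t + c * t \<le> f m + c * m"
    proof (rule decr)
      fix r assume "m \<le> r" "r \<le> t"
      then have "\<not> f r < a" using m(1) m(2)[of r] \<open>f m = a\<close> by auto
      then show "a \<le> f r" by simp
    qed (use m s \<open>m < t\<close> in auto)
    moreover have "c * m < c * t" using c \<open>m < t\<close> by simp
    ultimately show False using m nt by auto
  qed
  then show ?thesis by (auto simp: eventually_at_top_linorder)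
qed

text \<open>The slack \<open>1/10\<close> in \<open>A \<ge> n - 21/10\<close> leaves room for the error \<open>1/20\<close> in \<open>L\<close>.\<close>

lemma drift_bound:
  fixes n m A L :: real
  assumes "n \<ge> 3" "m \<ge> 1" "A \<ge> n - 21/10" "L \<ge> m - 1/20"
  shows "(m + n - 2) / (L + A) * (A - A\<^sup>2 / n) - A \<le> - 1/10"
proof -
  let ?K = "m + n - 2"
  have "n - A \<le> 7/10 * n" using assms by simp
  then have "1 - A / n \<le> 7/10" using assms by (simp add: field_simps)
  then have "?K * (1 - A / n) \<le> ?K * (7/10)" using assms by (intro mult_left_mono) auto
  \<comment> \<open>Here \<open>L + A\<close> is at least \<open>?K - 3/20\<close>, and
    \<open>?K\<close> is at least 2. The final bound is then \<open>- A / 5\<close> with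
    \<open>A\<close> at least \<open>9/10\<close>.\<close>
  also have "\<dots> \<le> 8/10 * (L + A)" using assms by simp
  finally have "?K * (1 - A / n) / (L + A) \<le> 8/10"
    using assms by (simp add: pos_divide_le_eq)
  then have "A * (?K * (1 - A / n) / (L + A)) \<le> A * (8/10)"
    using assms by (intro mult_left_mono) auto
  moreover have "?K / (L + A) * (A - A\<^sup>2 / n) = A * (?K * (1 - A / n) / (L + A))"
    using assms by (simp add: power2_eq_square field_simps)
  ultimately show ?thesis using assms by linarith
qed

text \<open>The analytic core, free of graphs: \<open>N\<close> stands for the neighbours of
  \<open>v\<close>, \<open>L\<close> for the leaves among them, \<open>y z\<close> for the weight of
  \<open>vz\<close>. The excess \<open>g\<close> is the contribution of the far endpoint.\<close>

lemma eventually_leaf_growth: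
  fixes y :: "'b \<Rightarrow> real \<Rightarrow> real"
  assumes fin: "finite N" and LN: "L \<subseteq> N" and u: "u \<in> L"
    and pos: "\<And>z t. z \<in> N \<Longrightarrow> t > 0 \<Longrightarrow> y z t > 0"
    and leaf: "\<And>z t. z \<in> L \<Longrightarrow> t > 0 \<Longrightarrow> (y z has_real_derivative F t - y z t) (at t)"
    and inner: "\<And>z t. z \<in> N - L \<Longrightarrow> t > 0 \<Longrightarrow>
      \<exists>g\<ge>0. (y z has_real_derivative F t + g) (at t)"
    and F: "\<And>t. t > 0 \<Longrightarrow> F t = (real (card N) - 2) / (\<Sum>z\<in>N. 1 / y z t)"
    and lim: "filterlim (y u) at_top at_top"
  shows "eventually (\<lambda>t. y u t < F t) at_top"
proof -
  define x where "x = y u"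
  have uN: "u \<in> N" and finL: "finite L" using u LN fin finite_subset by auto
  have xpos: "x t > 0" if "t > 0" for t using pos uN that by (simp add: x_def)
  have Dpos: "(\<Sum>z\<in>N. 1 / y z t) > 0" if "t > 0" for t
    using pos that fin uN by (intro sum_pos2[of _ u]) (auto intro: less_imp_le)
  have xder: "(x has_real_derivative F t - x t) (at t)" if "t > 0" for t
    using leaf[OF u that] by (simp add: x_def)
  \<comment> \<open>\<open>F\<close> cancels in the difference of two leaf equations, which leaves
    \<open>d' = - d\<close>.\<close>
  have "\<exists>c. \<forall>t\<in>{0<..}. exp t * (y z t - x t) = c" if "z \<in> L" for z
  proof (rule has_field_derivative_zero_constant)
    fix t :: real assume "t \<in> {0<..}"
    then have "((\<lambda>t. exp t * (y z t - x t)) has_real_derivative 0) (at t)"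
      using DERIV_mult[OF DERIV_exp DERIV_diff[OF leaf[OF that] xder], of t]
      by (simp add: algebra_simps)
    then show "((\<lambda>t. exp t * (y z t - x t)) has_real_derivative 0) (at t within {0<..})"
      by (rule has_field_derivative_at_within)
  qed simp
  then obtain c where "\<And>z t. z \<in> L \<Longrightarrow> t > 0 \<Longrightarrow> exp t * (y z t - x t) = c z"
    by (metis greaterThan_iff)
  then have leaf_eq: "y z t = x t + c z * exp (- t)" if "z \<in> L" "t > 0" for z t
    using that by (simp add: exp_minus field_simps)
  have cardL: "card L \<ge> 1" using u finL by (metis One_nat_def Suc_leI card_gt_0_iff empty_iff)
  have few_leaves: "card L + 3 \<le> card N"
  proof (rule ccontr)
    assume "\<not> ?thesis"
    then have KL: "real (card N) - 2 \<le> real (card L)" by simp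
    define C where "C = (\<Sum>z\<in>L. \<bar>c z\<bar>)"
    have C: "c z \<le> C" if "z \<in> L" for z
      using member_le_sum[of z L "\<lambda>z. \<bar>c z\<bar>"] that finL unfolding C_def by force
    have "C \<ge> 0" by (simp add: C_def sum_nonneg)
    \<comment> \<open>Every leaf weight is at most \<open>?b\<close>, so the reciprocals sum to at
      least \<open>card L / ?b\<close>, hence to at least \<open>(card N - 2) / ?b\<close>.\<close>
    have Fle: "F t \<le> x t + C * exp (- t)" if t: "t > 0" for t
    proof -
      let ?b = "x t + C * exp (- t)"
      have b: "?b > 0" using xpos[OF t] \<open>C \<ge> 0\<close> by (simp add: add_pos_nonneg)
      have "1 / ?b \<le> 1 / y z t" if "z \<in> L" for z
        using that t pos[of z t] LN C[OF that] leaf_eq[OF that t] b by (auto intro!: divide_left_mono)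
      then have "(\<Sum>z\<in>L. 1 / ?b) \<le> (\<Sum>z\<in>L. 1 / y z t)" by (rule sum_mono)
      also have "\<dots> \<le> (\<Sum>z\<in>N. 1 / y z t)"
        using fin LN pos t by (intro sum_mono2) (auto intro: less_imp_le)
      finally have "real (card L) \<le> (\<Sum>z\<in>N. 1 / y z t) * ?b"
        using b by (simp add: pos_divide_le_eq)
      then have "real (card N) - 2 \<le> ?b * (\<Sum>z\<in>N. 1 / y z t)" using KL by (simp add: mult.commute)
      then show ?thesis unfolding F[OF t] using Dpos[OF t] by (simp add: pos_divide_le_eq)
    qed
    \<comment> \<open>The derivative of the left side is \<open>F t - x t - C * exp (- t)\<close>,
      nonpositive by \<open>Fle\<close>; so \<open>x\<close> would be bounded.\<close>
    have "x t + C * exp (- t) \<le> x 1 + C * exp (- 1)" if "t \<ge> 1" for t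
    proof (rule DERIV_nonpos_imp_nonincreasing[OF that, of "\<lambda>t. x t + C * exp (- t)"])
      fix r :: real assume "1 \<le> r"
      then show "\<exists>d. ((\<lambda>t. x t + C * exp (- t)) has_real_derivative d) (at r) \<and> d \<le> 0"
        using Fle[of r]
        by (intro exI[of _ "F r - x r - C * exp (- r)"]) (auto intro!: derivative_eq_intros xder)
    qed
    moreover have "C * exp (- t) \<ge> 0" for t using \<open>C \<ge> 0\<close> by simp
    ultimately have "x t \<le> x 1 + C * exp (- 1)" if "t \<ge> 1" for t
      using that by (metis add_increasing2 order.refl order_trans)
    then have "eventually (\<lambda>t. x t \<le> x 1 + C * exp (- 1)) at_top"
      by (auto simp: eventually_at_top_linorder)
    moreover have "eventually (\<lambda>t. x t > x 1 + C * exp (- 1)) at_top"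
      using lim by (simp add: x_def filterlim_at_top_dense)
    ultimately have "eventually (\<lambda>t::real. False) at_top" by eventually_elim simp
    then show False by simp
  qed
  define n m where "n = real (card (N - L))" and "m = real (card L)"
  have nm: "n + m = real (card N)"
    using card_Diff_subset[OF finL LN] card_mono[OF fin LN] by (simp add: n_def m_def)
  have n3: "n \<ge> 3" and m1: "m \<ge> 1" using few_leaves cardL nm by (auto simp: m_def)
  define A where "A t = (\<Sum>z\<in>N - L. x t / y z t)" for t
  define B where "B t = (\<Sum>z\<in>L. x t / y z t)" for t
  have BA: "B t + A t = x t * (\<Sum>z\<in>N. 1 / y z t)" for t
    using sum.subset_diff[OF LN fin, of "\<lambda>z. x t / y z t"]
    by (simp add: A_def B_def sum_distrib_left)
  have BA_pos: "B t + A t > 0" if "t > 0" for t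
    unfolding BA using xpos[OF that] Dpos[OF that] by simp
  have F_eq: "F t = x t * ((m + n - 2) / (B t + A t))" if "t > 0" for t
    unfolding BA F[OF that] using xpos[OF that] nm by (simp add: add.commute)
  have "((\<lambda>t. x t / y z t) \<longlongrightarrow> 1) at_top" if "z \<in> L" for z
  proof -
    have "filterlim (\<lambda>t::real. - t) at_bot at_top" by (rule filterlim_uminus_at_bot_at_top)
    then have "((\<lambda>t::real. exp (- t)) \<longlongrightarrow> 0) at_top" by (rule filterlim_compose[OF exp_at_bot])
    moreover have "((\<lambda>t. inverse (x t)) \<longlongrightarrow> 0) at_top"
      using lim unfolding x_def by (rule tendsto_inverse_0_at_top)
    ultimately have "((\<lambda>t. 1 / (1 + c z * exp (- t) * inverse (x t))) \<longlongrightarrow> 1 / (1 + c z * 0 * 0)) at_top"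
      by (intro tendsto_intros) auto
    moreover have "eventually (\<lambda>t. 1 / (1 + c z * exp (- t) * inverse (x t)) = x t / y z t) at_top"
      using eventually_gt_at_top[of 0]
    proof eventually_elim
      case (elim t)
      then have "1 + c z * exp (- t) * inverse (x t) = y z t / x t"
        using leaf_eq[OF that elim] xpos[OF elim] by (simp add: field_simps)
      then show ?case by simp
    qed
    ultimately show ?thesis by (simp add: filterlim_cong)
  qed
  then have "(B \<longlongrightarrow> (\<Sum>z\<in>L. 1)) at_top" unfolding B_def by (intro tendsto_sum) auto
  then have "eventually (\<lambda>t. dist (B t) m < 1/20) at_top"
    by (intro tendstoD) (auto simp: m_def)
  then obtain T where T: "T > 0" "\<And>t. t \<ge> T \<Longrightarrow> \<bar>B t - m\<bar> < 1/20"
    unfolding eventually_at_top_linorder dist_real_def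
    by (meson gt_ex less_le_trans max.cobounded1 max.cobounded2 max.strict_coboundedI1 order_trans)
  obtain g where g: "\<And>z t. z \<in> N - L \<Longrightarrow> t > 0 \<Longrightarrow> g z t \<ge> 0"
    "\<And>z t. z \<in> N - L \<Longrightarrow> t > 0 \<Longrightarrow> (y z has_real_derivative F t + g z t) (at t)"
    using inner by metis
  define A' where "A' t = (\<Sum>z\<in>N - L. ((F t - x t) * y z t - x t * (F t + g z t)) / (y z t * y z t))" for t
  have Ader: "(A has_real_derivative A' t) (at t)" if "t > 0" for t
    unfolding A_def A'_def using pos[OF _ that]
    by (intro DERIV_sum DERIV_divide xder g that) force+
  have "eventually (\<lambda>t. A t \<le> n - 21/10) at_top"
  proof (rule eventually_le_of_drift[of "1/10" T])
    fix t assume t: "T \<le> t" and big: "n - 21/10 \<le> A t"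
    then have t0: "t > 0" using T by simp
    define \<phi> where "\<phi> = (m + n - 2) / (B t + A t)"
    have Ft: "F t = x t * \<phi>" using F_eq t0 by (simp add: \<phi>_def)
    have \<phi>: "\<phi> \<ge> 0" using BA_pos[OF t0] n3 m1 by (simp add: \<phi>_def)
    \<comment> \<open>With \<open>a = x t / y z t\<close> each summand is
      \<open>\<phi> * (a - a * a) - a\<close> minus a nonnegative multiple of \<open>g z t\<close>,
      which is dropped.\<close>
    have "A' t \<le> (\<Sum>z\<in>N - L. \<phi> * (x t / y z t - (x t / y z t)\<^sup>2) - x t / y z t)"
      unfolding A'_def
    proof (rule sum_mono)
      fix z assume z: "z \<in> N - L"
      have yp: "y z t > 0" using pos z t0 by simp
      have "((F t - x t) * y z t - x t * (F t + g z t)) / (y z t * y z t)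
          = \<phi> * (x t / y z t - (x t / y z t)\<^sup>2) - x t / y z t - x t * g z t / (y z t * y z t)"
        using yp unfolding Ft by (simp add: field_simps power2_eq_square)
      moreover have "x t * g z t / (y z t * y z t) \<ge> 0"
        using yp g(1)[OF z t0] xpos[OF t0] by simp
      ultimately show "((F t - x t) * y z t - x t * (F t + g z t)) / (y z t * y z t)
          \<le> \<phi> * (x t / y z t - (x t / y z t)\<^sup>2) - x t / y z t" by linarith
    qed
    also have "\<dots> = \<phi> * (A t - (\<Sum>z\<in>N - L. (x t / y z t)\<^sup>2)) - A t"
      unfolding A_def by (simp add: sum_subtractf sum_distrib_left[symmetric])
    also have "\<dots> \<le> \<phi> * (A t - (A t)\<^sup>2 / n) - A t"
    proof -
      have "(A t)\<^sup>2 / n \<le> (\<Sum>z\<in>N - L. (x t / y z t)\<^sup>2)"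
        using sum_squared_le_sum_of_squares[of "\<lambda>z. x t / y z t" "N - L"] n3
        unfolding A_def n_def by (simp add: pos_divide_le_eq)
      then show ?thesis using \<phi> by (simp add: mult_left_mono)
    qed
    also have "\<dots> \<le> - 1/10"
    proof -
      have "B t \<ge> m - 1/20" using T(2)[OF t] by linarith
      then show ?thesis unfolding \<phi>_def by (rule drift_bound[OF n3 m1 big])
    qed
    finally show "A' t \<le> - (1/10)" by simp
  qed (use T in \<open>auto intro: Ader\<close>)
  then show ?thesis using eventually_ge_at_top[of T]
  proof eventually_elim
    case (elim t)
    then have t0: "t > 0" using T by simp
    \<comment> \<open>The margin \<open>1/10\<close> in the bound on \<open>A\<close> exceeds the
      error \<open>1/20\<close> in \<open>B\<close>.\<close>
    have "B t + A t < m + n - 2" using elim T(2)[of t] by linarith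
    then have "(m + n - 2) / (B t + A t) > 1" using BA_pos[OF t0] by (simp add: pos_less_divide_eq)
    then have "x t * 1 < F t" unfolding F_eq[OF t0] using xpos[OF t0] by (intro mult_strict_left_mono) auto
    then show ?case by (simp add: x_def)
  qed
qed

section \<open>The Ricci flow at a leaf edge\<close>

lemma ricci_flow_DERIV:
  assumes "ricci_flow V E w" "t > 0" "{x, y} \<in> E"
  shows "((\<lambda>s. w s {x, y}) has_real_derivative - curvature V E (w t) x y * w t {x, y}) (at t)"
proof -
  have "((\<lambda>s. w s {x, y}) has_real_derivative - curvature V E (w t) x y * w t {x, y}) (at t within {0..})"
    using assms by (auto simp: ricci_flow_def)
  then have "((\<lambda>s. w s {x, y}) has_real_derivative - curvature V E (w t) x y * w t {x, y}) (at t within {0<..})"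
    by (rule has_field_derivative_subset) auto
  then show ?thesis using \<open>t > 0\<close> by (simp add: at_within_open[of t "{0<..}"])
qed

text \<open>For a leaf \<open>u\<close> the weighted degree is \<open>1 / w_uv\<close>, so the
  curvature of \<open>uv\<close> is \<open>1 - F / w_uv\<close>, and its sign is that of
  \<open>w_uv - F\<close>.\<close>

lemma eventually_leaf_curvature_neg:
  fixes u v :: 'a
  assumes tree: "is_tree V E" and flow: "ricci_flow V E w"
    and uv: "{u, v} \<in> E" and u: "degree E u = 1"
    and lim: "filterlim (\<lambda>t. w t {u, v}) at_top at_top"
  shows "eventually (\<lambda>t. curvature V E (w t) u v < 0) at_top"
proof -
  have wt: "weighted_tree V E (w t)" if "t \<ge> 0" for t
    using tree flow that by (auto simp: weighted_tree_def ricci_flow_def)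
  define N where "N = neighbours E v"
  define L where "L = {z \<in> N. degree E z = 1}"
  define y where "y z t = w t {v, z}" for z t
  define F where "F t = (real (card N) - 2) / (\<Sum>z\<in>N. 1 / y z t)" for t
  have finN: "finite N" unfolding N_def using weighted_tree.finite_neighbours[OF wt, of 0] by simp
  have D: "weighted_degree E (w t) v = (\<Sum>z\<in>N. 1 / y z t)" for t
    by (simp add: weighted_degree_def N_def y_def)
  have deg: "degree E v = card N" by (simp add: degree_def N_def)
  have edge: "{v, z} \<in> E" "{z, v} \<in> E" if "z \<in> N" for z
    using that by (auto simp: N_def neighbours_def insert_commute)
  have uL: "u \<in> L" using uv u by (auto simp: L_def N_def neighbours_def insert_commute)
  have pos: "y z t > 0" if "z \<in> N" "t > 0" for z t
    using weighted_tree.pos[OF wt[of t] edge(1)[OF that(1)]] that by (simp add: y_def)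
  \<comment> \<open>The weight cancels in curvature times weight. The term of \<open>v\<close> is
    the same \<open>F\<close> for all its edges; only the term of the far endpoint \<open>z\<close>
    varies.\<close>
  have der: "(y z has_real_derivative F t + (real (degree E z) - 2) / weighted_degree E (w t) z) (at t)"
    if "z \<in> N" "t > 0" for z t
  proof -
    note formula = weighted_tree.curvature_edge[OF wt edge(1)[OF that(1)], of t]
    have "- curvature V E (w t) v z * w t {v, z}
        = F t + (real (degree E z) - 2) / weighted_degree E (w t) z"
      using pos[OF that] that unfolding formula[OF less_imp_le[OF that(2)]] F_def D deg y_def[symmetric]
      by (simp add: distrib_right minus_divide_left)
    then show ?thesis
      using ricci_flow_DERIV[OF flow that(2) edge(1)[OF that(1)]] by (simp add: y_def[abs_def])
  qed
  have leaf_degree: "weighted_degree E (w t) z = 1 / y z t" if "z \<in> L" for z t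
  proof -
    have "v \<in> neighbours E z" "card (neighbours E z) = 1"
      using that edge(2)[of z] by (auto simp: L_def neighbours_def degree_def)
    then have "neighbours E z = {v}" by (metis card_1_singletonE singletonD)
    then show ?thesis by (simp add: weighted_degree_def y_def insert_commute)
  qed
  have "eventually (\<lambda>t. y u t < F t) at_top"
  proof (rule eventually_leaf_growth[OF finN _ uL pos _ _ F_def])
    show "L \<subseteq> N" by (auto simp: L_def)
    then show "(y z has_real_derivative F t - y z t) (at t)" if "z \<in> L" "t > 0" for z t
      using der[of z t] that leaf_degree[OF that(1), of t] by (auto simp: L_def)
    \<comment> \<open>As \<open>v\<close> is a neighbour of \<open>z\<close>, a non-leaf
      \<open>z\<close> has degree at least 2, so its term is nonnegative.\<close>
    show "\<exists>g\<ge>0. (y z has_real_derivative F t + g) (at t)" if z: "z \<in> N - L" and t: "t > 0" for z t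
    proof -
      have "v \<in> neighbours E z" using edge(2)[of z] z by (simp add: neighbours_def)
      then have "degree E z \<noteq> 0"
        using weighted_tree.finite_neighbours[OF wt, of 0 z] by (auto simp: degree_def)
      then have "degree E z \<ge> 2" using z by (auto simp: L_def)
      moreover have "weighted_degree E (w t) z > 0"
        using weighted_tree.weighted_degree_pos[OF wt edge(2)] z t by simp
      ultimately show ?thesis using der[of z t] z t
        by (intro exI[of _ "(real (degree E z) - 2) / weighted_degree E (w t) z"]) auto
    qed
    show "filterlim (y u) at_top at_top" using lim by (simp add: y_def[abs_def] insert_commute)
  qed
  then show ?thesis using eventually_gt_at_top[of 0]
  proof eventually_elim
    case (elim t)
    have "y u t > 0" using pos elim uL by (simp add: L_def)
    moreover have "w t {u, v} = y u t" by (simp add: y_def insert_commute)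
    moreover have "(2 - real (card N)) / (y u t * (\<Sum>z\<in>N. 1 / y z t)) = - F t / y u t"
      by (simp add: F_def minus_divide_left)
    ultimately have "curvature V E (w t) u v = 1 - F t / y u t"
      using weighted_tree.curvature_edge[OF wt uv, of t] elim leaf_degree[OF uL, of t] u
      by (simp add: D deg)
    then show ?case using elim \<open>y u t > 0\<close> by (simp add: less_divide_eq)
  qed
qed

theorem proposition4:
  fixes V :: "'a set" and E :: "'a set set" and w :: "real \<Rightarrow> 'a set \<Rightarrow> real" and u v :: 'a
  assumes "is_tree V E"
    and "\<not> is_path_graph V E"
    and "\<not> is_star_graph V E"
    and "ricci_flow V E w"
    and "is_leaf_edge E {u, v}"
    and "filterlim (\<lambda>t. w t {u, v}) at_top at_top"
  shows "\<exists>t0\<ge>0. (\<forall>t\<ge>t0. curvature V E (w t) u v < 0)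
                \<and> strict_mono_on {t0..} (\<lambda>t. w t {u, v})"
proof -
  have uv: "{u, v} \<in> E" and vu: "{v, u} \<in> E"
    using assms(5) by (auto simp: is_leaf_edge_def insert_commute)
  have wt: "weighted_tree V E (w t)" if "t \<ge> 0" for t
    using assms(1,4) that by (auto simp: weighted_tree_def ricci_flow_def)
  \<comment> \<open>Curvature takes an ordered pair, while either endpoint may be the leaf.\<close>
  have sym: "curvature V E (w t) v u = curvature V E (w t) u v" if "t \<ge> 0" for t
    using weighted_tree.curvature_edge[OF wt[OF that] uv]
      weighted_tree.curvature_edge[OF wt[OF that] vu] by (simp add: insert_commute)
  consider "degree E u = 1" | "degree E v = 1" using assms(5) by (auto simp: is_leaf_edge_def)
  then have "eventually (\<lambda>t. curvature V E (w t) u v < 0) at_top"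
  proof cases
    case 1
    then show ?thesis using eventually_leaf_curvature_neg[OF assms(1,4) uv] assms(6) by simp
  next
    case 2
    then have "eventually (\<lambda>t. curvature V E (w t) v u < 0) at_top"
      using eventually_leaf_curvature_neg[OF assms(1,4) vu] assms(6) by (simp add: insert_commute)
    then show ?thesis using eventually_ge_at_top[of 0] by eventually_elim (simp add: sym)
  qed
  \<comment> \<open>Positive times make the derivative of the flow two-sided from \<open>t0\<close>
    on.\<close>
  then have "eventually (\<lambda>t. curvature V E (w t) u v < 0 \<and> t > 0) at_top"
    using eventually_gt_at_top[of 0] by (rule eventually_conj)
  then obtain t0 where t0: "curvature V E (w t) u v < 0" "t > 0" if "t \<ge> t0" for t
    by (auto simp: eventually_at_top_linorder)
  have "strict_mono_on {t0..} (\<lambda>t. w t {u, v})"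
  proof (rule strict_mono_onI)
    fix r s assume "r \<in> {t0..}" "s \<in> {t0..}" "r < s"
    then show "w r {u, v} < w s {u, v}"
    proof (intro DERIV_pos_imp_increasing[of r s "\<lambda>t. w t {u, v}"])
      fix t assume "r \<le> t" "t \<le> s"
      then have t: "t \<ge> t0" using \<open>r \<in> {t0..}\<close> by simp
      have "w t {u, v} > 0" using weighted_tree.pos[OF wt uv] t0(2)[OF t] by simp
      then have "- curvature V E (w t) u v * w t {u, v} > 0" using t0(1)[OF t] by (simp add: mult_neg_pos)
      then show "\<exists>d. ((\<lambda>t. w t {u, v}) has_real_derivative d) (at t) \<and> 0 < d"
        using ricci_flow_DERIV[OF assms(4) t0(2)[OF t] uv] by blast
    qed
  qed
  then show ?thesis using t0 by (intro exI[of _ t0]) (auto intro: less_imp_le)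
qed

end
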